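(* For every integer $n\ge 0$, $$\beta_{n,\lambda}(x)=\sum_{k=0}^{n}\frac{(-1)^{k}}{k+1}\,k!\,S_{2,\lambda}(n,k\,|\,x)=\sum_{k=0}^{n}\frac{1}{k+1}\sum_{l=0}^{k}\binom{k}{l}(-1)^{l}(l+x)_{n,\lambda}.$$
   Context: Let $\lambda\in\mathbb{R}$. $(x)_{0,\lambda}=1$, $(x)_{n,\lambda}=x(x-\lambda)\cdots(x-(n-1)\lambda)$ for $n\ge1$. $e_\lambda^x(t)=\sum_{k\ge0}(x)_{k,\lambda}t^k/k!$ (formal power series in $t$), $e_\lambda(t)=e_\lambda^1(t)$. The fully degenerate Bernoulli polynomials are defined by $\frac{\log(1+\lambda t)}{\lambda(e_\lambda(t)-1)}e_\lambda^x(t)=\sum_{n\ge0}\beta_{n,\lambda}(x)\frac{t^n}{n!}$ (for $\lambda=0$ interpret $\log(1+\lambda t)/\lambda$ as $t$ and $e_0^x(t)=e^{xt}$). For an integer $k\ge0$, the degenerate Stirling polynomials $S_{2,\lambda}(n,k\,|\,x)$ are defined by $\frac{1}{k!}(e_\lambda(t)-1)^k e_\lambda^x(t)=\sum_{n\ge k}S_{2,\lambda}(n,k\,|\,x)\frac{t^n}{n!}$. *)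

theory Defs
  imports Complex_Main "HOL-Computational_Algebra.Formal_Power_Series"
begin

definition deg_falling :: "real \<Rightarrow> real \<Rightarrow> nat \<Rightarrow> real" where
  "deg_falling lam x n = (\<Prod>i<n. x - real i * lam)"

definition deg_exp :: "real \<Rightarrow> real \<Rightarrow> real fps" where
  "deg_exp lam x = Abs_fps (\<lambda>k. deg_falling lam x k / fact k)"

text \<open>The series \<open>log (1 + lam t) / lam\<close>, read as \<open>t\<close> for \<open>lam = 0\<close>;
  \<open>fps_ln 1\<close> is the series of \<open>log (1 + t)\<close>.\<close>

definition deg_log :: "real \<Rightarrow> real fps" where
  "deg_log lam =
     (if lam = 0 then fps_X
      else fps_const (1 / lam) * (fps_ln 1 oo (fps_const lam * fps_X)))"

text \<open>The divisor below has zero constant term, but so has \<open>deg_log lam\<close>, and the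
  library's division of power series cancels the common factor \<open>t\<close>; see
  \<open>deg_log_div_mult\<close>.\<close>

definition deg_bernoulli :: "real \<Rightarrow> nat \<Rightarrow> real \<Rightarrow> real" where
  "deg_bernoulli lam n x =
     fact n * fps_nth (deg_log lam / (deg_exp lam 1 - 1) * deg_exp lam x) n"

text \<open>The value is \<open>0\<close> for \<open>n < k\<close>, so the generating series indeed starts at \<open>n = k\<close>;
  see \<open>deg_stirling2_eq_0\<close>.\<close>

definition deg_stirling2 :: "real \<Rightarrow> nat \<Rightarrow> nat \<Rightarrow> real \<Rightarrow> real" where
  "deg_stirling2 lam n k x =
     fact n * fps_nth (fps_const (1 / fact k) * (deg_exp lam 1 - 1) ^ k * deg_exp lam x) n"

lemma deg_exp_0: "deg_exp 0 x = fps_exp x"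
  by (simp add: deg_exp_def deg_falling_def fps_eq_iff)

lemma subdegree_deg_exp_minus_1: "subdegree (deg_exp lam 1 - 1) = 1"
  by (rule subdegreeI) (auto simp: deg_exp_def deg_falling_def)

lemma deg_log_nth_0: "fps_nth (deg_log lam) 0 = 0"
  by (simp add: deg_log_def)

lemma deg_log_div_mult: "deg_log lam / (deg_exp lam 1 - 1) * (deg_exp lam 1 - 1) = deg_log lam"
proof -
  have "deg_exp lam 1 - 1 \<noteq> 0"
    using subdegree_deg_exp_minus_1[of lam] by auto
  moreover have "deg_log lam = 0 \<or> subdegree (deg_log lam) \<ge> 1"
    using deg_log_nth_0[of lam] by (metis less_one not_less nth_subdegree_nonzero)
  ultimately have "deg_exp lam 1 - 1 dvd deg_log lam"
    by (cases "deg_log lam = 0") (auto simp: fps_dvd_iff subdegree_deg_exp_minus_1 simp del: subdegree_minus_commute)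
  then show ?thesis
    by simp
qed

lemma deg_stirling2_eq_0:
  assumes "n < k"
  shows "deg_stirling2 lam n k x = 0"
proof -
  have "fps_nth ((deg_exp lam 1 - 1) ^ k) i = 0" if "i < k" for i
    using that by (intro nth_less_subdegree_zero) (simp add: subdegree_deg_exp_minus_1 del: subdegree_minus_commute)
  then show ?thesis
    using assms by (simp add: deg_stirling2_def mult.assoc fps_mult_nth)
qed

end

theory Submission
  imports Defs
begin

text \<open>Write \<open>e\<close> for \<open>deg_exp lam 1\<close>. The series \<open>f = deg_exp lam x\<close> is the solution of
  \<open>(1 + lam t) f' = x f\<close> with \<open>f(0) = 1\<close>. This gives the exponential law
  \<open>deg_exp lam (x + y) = deg_exp lam x * deg_exp lam y\<close>, and also \<open>deg_log lam = log (1 + (e - 1))\<close>,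
  both sides having derivative \<open>1 / (1 + lam t)\<close>. Dividing the logarithmic series in \<open>e - 1\<close> by
  \<open>e - 1\<close> gives the first formula; expanding \<open>(1 - e) ^ k\<close> by the binomial theorem gives the
  second.\<close>

lemma deg_exp_nth_0 [simp]: "fps_nth (deg_exp lam x) 0 = 1"
  by (simp add: deg_exp_def deg_falling_def)

text \<open>Turns a differential equation with the factor \<open>1 + lam t\<close> into a two-term
  recurrence for coefficients; it serves both \<open>deg_exp\<close> and
  \<open>deg_log\<close>.\<close>

lemma fps_nth_linear_mult_deriv:
  fixes f :: "real fps"
  shows "fps_nth ((1 + fps_const lam * fps_X) * fps_deriv f) n =
    real (Suc n) * fps_nth f (Suc n) + lam * real n * fps_nth f n"
  by (cases n) (simp_all add: distrib_right mult.assoc)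

lemma deg_exp_ODE:
  "(1 + fps_const lam * fps_X) * fps_deriv (deg_exp lam x) = fps_const x * deg_exp lam x"
proof (rule fps_ext)
  fix n
  have "real (Suc n) * fps_nth (deg_exp lam x) (Suc n) = (x - real n * lam) * fps_nth (deg_exp lam x) n"
    by (simp add: deg_exp_def deg_falling_def field_simps del: of_nat_Suc)
  then show "fps_nth ((1 + fps_const lam * fps_X) * fps_deriv (deg_exp lam x)) n =
      fps_nth (fps_const x * deg_exp lam x) n"
    unfolding fps_nth_linear_mult_deriv by (simp add: algebra_simps del: of_nat_Suc)
qed

text \<open>The recurrence fixes coefficient \<open>Suc n\<close> from coefficient \<open>n\<close>,
  because \<open>real (Suc n)\<close> is nonzero.\<close>

lemma deg_exp_ODE_unique:
  assumes ode: "(1 + fps_const lam * fps_X) * fps_deriv f = fps_const x * f"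
    and init: "fps_nth f 0 = 1"
  shows "f = deg_exp lam x"
proof (rule fps_ext)
  fix n
  have rec: "real (Suc n) * fps_nth g (Suc n) + lam * real n * fps_nth g n = x * fps_nth g n"
    if "(1 + fps_const lam * fps_X) * fps_deriv g = fps_const x * g" for g n
    using arg_cong[OF that, of "\<lambda>h. fps_nth h n"] unfolding fps_nth_linear_mult_deriv by simp
  show "fps_nth f n = fps_nth (deg_exp lam x) n"
  proof (induction n)
    case 0
    then show ?case by (simp add: init)
  next
    case (Suc n)
    have "real (Suc n) * fps_nth f (Suc n) = real (Suc n) * fps_nth (deg_exp lam x) (Suc n)"
      using rec[OF ode, of n] rec[OF deg_exp_ODE, of n] Suc.IH
      by (metis add_right_cancel)
    then show ?case by (simp del: of_nat_Suc)
  qed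
qed

lemma deg_exp_add: "deg_exp lam (x + y) = deg_exp lam x * deg_exp lam y"
proof (rule deg_exp_ODE_unique[symmetric])
  have "(1 + fps_const lam * fps_X) * fps_deriv (deg_exp lam x * deg_exp lam y) =
      deg_exp lam x * ((1 + fps_const lam * fps_X) * fps_deriv (deg_exp lam y)) +
      ((1 + fps_const lam * fps_X) * fps_deriv (deg_exp lam x)) * deg_exp lam y"
    by (simp add: algebra_simps)
  also have "\<dots> = fps_const (x + y) * (deg_exp lam x * deg_exp lam y)"
    unfolding deg_exp_ODE by (simp add: algebra_simps flip: fps_const_add)
  finally show "(1 + fps_const lam * fps_X) * fps_deriv (deg_exp lam x * deg_exp lam y) =
      fps_const (x + y) * (deg_exp lam x * deg_exp lam y)" .
qed simp

lemma deg_exp_power: "deg_exp lam x ^ l = deg_exp lam (real l * x)"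
proof (induction l)
  case 0
  \<comment> \<open>The constant series 1 solves the equation with parameter 0.\<close>
  show ?case by (rule deg_exp_ODE_unique) simp_all
next
  case (Suc l)
  then show ?case by (simp add: deg_exp_add distrib_right)
qed

lemma deg_log_nth_Suc: "fps_nth (deg_log lam) (Suc n) = (- lam) ^ n / real (Suc n)"
proof (cases "lam = 0")
  case True
  \<comment> \<open>Here \<open>0 ^ 0 = 1\<close> yields the single nonzero coefficient of
    \<open>fps_X\<close>.\<close>
  then show ?thesis by (simp add: deg_log_def power_0_left)
next
  case False
  then show ?thesis
    by (simp add: deg_log_def fps_compose_linear fps_ln_nth power_minus[of lam])
qed

lemma deg_log_deriv: "(1 + fps_const lam * fps_X) * fps_deriv (deg_log lam) = 1"
proof (rule fps_ext)
  fix n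
  show "fps_nth ((1 + fps_const lam * fps_X) * fps_deriv (deg_log lam)) n = fps_nth 1 n"
    unfolding fps_nth_linear_mult_deriv
    by (cases n) (simp_all add: deg_log_nth_Suc deg_log_nth_0 del: of_nat_Suc)
qed

lemma deg_log_eq_ln_compose: "deg_log lam = fps_ln 1 oo (deg_exp lam 1 - 1)"
proof -
  let ?e = "deg_exp lam 1" and ?c = "1 + fps_const lam * fps_X :: real fps"
  \<comment> \<open>Composition commutes with the inverse since \<open>?e - 1\<close> has zero
    constant term.\<close>
  have "inverse (1 + fps_X) oo (?e - 1) = inverse ?e"
    by (simp add: fps_inverse_compose fps_compose_add_distrib)
  then have "fps_deriv (fps_ln 1 oo (?e - 1)) = inverse ?e * fps_deriv ?e"
    by (simp add: fps_compose_deriv fps_ln_deriv)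
  then have "?c * fps_deriv (fps_ln 1 oo (?e - 1)) = inverse ?e * (?c * fps_deriv ?e)"
    by (simp only: mult_ac)
  also have "\<dots> = ?c * fps_deriv (deg_log lam)"
    unfolding deg_exp_ODE deg_log_deriv by (simp add: inverse_mult_eq_1)
  finally have "?c * fps_deriv (deg_log lam) = ?c * fps_deriv (fps_ln 1 oo (?e - 1))"
    by (rule sym)
  moreover have "fps_nth ?c 0 \<noteq> 0" by simp
  then have "?c \<noteq> 0" by force
  ultimately have "fps_deriv (deg_log lam) = fps_deriv (fps_ln 1 oo (?e - 1))"
    using mult_left_cancel by blast
  then show ?thesis
    by (simp add: fps_deriv_eq_iff deg_log_nth_0)
qed

lemma deg_log_div_eq_compose:
  "deg_log lam / (deg_exp lam 1 - 1) =
    Abs_fps (\<lambda>k. (-1) ^ k / (real k + 1)) oo (deg_exp lam 1 - 1)"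
proof -
  let ?u = "deg_exp lam 1 - 1" and ?a = "Abs_fps (\<lambda>k. (-1) ^ k / (real k + 1))"
  have "?u \<noteq> 0"
    using subdegree_deg_exp_minus_1[of lam] by auto
  \<comment> \<open>The logarithm has no constant term, so \<open>t\<close> splits off; after
    composition this factor becomes the divisor \<open>?u\<close>.\<close>
  have "fps_ln 1 = fps_X * ?a"
    by (rule fps_ext) (simp add: fps_ln_nth of_nat_diff)
  then have "deg_log lam = (?a oo ?u) * ?u"
    by (simp add: deg_log_eq_ln_compose fps_compose_mult_distrib)
  then show ?thesis
    using \<open>?u \<noteq> 0\<close> by simp
qed

text \<open>As \<open>b ^ k\<close> starts in degree \<open>k\<close> or later, only
  \<open>k \<le> n\<close> can contribute to coefficient \<open>n\<close>.\<close>

lemma fps_nth_compose_mult: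
  fixes a b c :: "'a::comm_ring_1 fps"
  assumes "fps_nth b 0 = 0"
  shows "fps_nth ((a oo b) * c) n = (\<Sum>k=0..n. fps_nth a k * fps_nth (b ^ k * c) n)"
proof -
  \<comment> \<open>Padding the range from \<open>i\<close> to \<open>n\<close> with zero terms
    makes it independent of \<open>i\<close>, so that the two sums can be swapped.\<close>
  have "fps_nth (a oo b) i = (\<Sum>k=0..n. fps_nth a k * fps_nth (b ^ k) i)" if "i \<le> n" for i
    unfolding fps_compose_nth
    by (rule sum.mono_neutral_left) (use that startsby_zero_power_prefix[OF assms] in auto)
  then have "fps_nth ((a oo b) * c) n =
      (\<Sum>i=0..n. \<Sum>k=0..n. fps_nth a k * (fps_nth (b ^ k) i * fps_nth c (n - i)))"
    by (simp add: fps_mult_nth sum_distrib_right mult.assoc)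
  also have "\<dots> = (\<Sum>k=0..n. fps_nth a k * fps_nth (b ^ k * c) n)"
    by (subst sum.swap) (simp add: fps_mult_nth sum_distrib_left)
  finally show ?thesis .
qed

lemma fact_mult_deg_stirling2:
  "fact k * deg_stirling2 lam n k x = fact n * fps_nth ((deg_exp lam 1 - 1) ^ k * deg_exp lam x) n"
  by (simp add: deg_stirling2_def mult.assoc)

lemma deg_bernoulli_eq_sum_stirling2:
  "deg_bernoulli lam n x =
    (\<Sum>k=0..n. (-1) ^ k / (real k + 1) * fact k * deg_stirling2 lam n k x)"
proof -
  have "deg_bernoulli lam n x = fact n *
      (\<Sum>k=0..n. (-1) ^ k / (real k + 1) * fps_nth ((deg_exp lam 1 - 1) ^ k * deg_exp lam x) n)"
    unfolding deg_bernoulli_def deg_log_div_eq_compose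
    by (subst fps_nth_compose_mult) simp_all
  also have "\<dots> = (\<Sum>k=0..n. (-1) ^ k / (real k + 1) * (fact k * deg_stirling2 lam n k x))"
    unfolding fact_mult_deg_stirling2 by (simp add: sum_distrib_left mult_ac)
  finally show ?thesis by (simp only: mult.assoc)
qed

lemma deg_stirling2_eq_binomial_sum:
  "(-1) ^ k * fact k * deg_stirling2 lam n k x =
    (\<Sum>l=0..k. real (k choose l) * (-1) ^ l * deg_falling lam (real l + x) n)"
proof -
  let ?e = "deg_exp lam 1"
  \<comment> \<open>Absorbing the sign first leaves \<open>(-1) ^ l\<close> rather than
    \<open>(-1) ^ (k - l)\<close> in the expansion.\<close>
  have "(-1) ^ k * (?e - 1) ^ k = (- ?e + 1) ^ k"
    by (simp flip: power_mult_distrib)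
  also have "\<dots> = (\<Sum>l\<le>k. of_nat (k choose l) * (- ?e) ^ l)"
    by (subst binomial_ring) simp
  also have "\<dots> = (\<Sum>l=0..k. fps_const (real (k choose l) * (-1) ^ l) * deg_exp lam (real l))"
    by (rule sum.cong)
      (auto simp: power_minus[of ?e] deg_exp_power fps_of_nat simp flip: fps_const_mult fps_const_power fps_const_neg)
  finally have "(-1) ^ k * (?e - 1) ^ k * deg_exp lam x =
      (\<Sum>l=0..k. fps_const (real (k choose l) * (-1) ^ l) * deg_exp lam (real l + x))"
    by (simp add: sum_distrib_right deg_exp_add mult.assoc)
  moreover have "(-1 :: real fps) ^ k = fps_const ((-1) ^ k)"
    by (simp flip: fps_const_power fps_const_neg)
  ultimately have "fps_const ((-1) ^ k) * ((?e - 1) ^ k * deg_exp lam x) =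
      (\<Sum>l=0..k. fps_const (real (k choose l) * (-1) ^ l) * deg_exp lam (real l + x))"
    by (simp only: mult.assoc)
  from arg_cong[OF this, of "\<lambda>f. fps_nth f n"]
  have "(-1) ^ k * fps_nth ((?e - 1) ^ k * deg_exp lam x) n =
      (\<Sum>l=0..k. real (k choose l) * (-1) ^ l * fps_nth (deg_exp lam (real l + x)) n)"
    by (simp only: fps_mult_left_const_nth fps_sum_nth)
  \<comment> \<open>The factor \<open>fact n\<close> cancels the denominator in the coefficients of
    \<open>deg_exp\<close>.\<close>
  then have "fact n * ((-1) ^ k * fps_nth ((?e - 1) ^ k * deg_exp lam x) n) =
      (\<Sum>l=0..k. real (k choose l) * (-1) ^ l * deg_falling lam (real l + x) n)"
    by (simp add: deg_exp_def sum_distrib_left)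
  then show ?thesis
    by (simp only: mult.assoc fact_mult_deg_stirling2 mult.left_commute[of "fact n"])
qed

theorem theorem6:
  fixes lam x :: real and n :: nat
  shows "deg_bernoulli lam n x =
           (\<Sum>k=0..n. (-1) ^ k / (real k + 1) * fact k * deg_stirling2 lam n k x)
       \<and> (\<Sum>k=0..n. (-1) ^ k / (real k + 1) * fact k * deg_stirling2 lam n k x) =
           (\<Sum>k=0..n. 1 / (real k + 1) *
              (\<Sum>l=0..k. real (k choose l) * (-1) ^ l * deg_falling lam (real l + x) n))"
  by (simp add: deg_bernoulli_eq_sum_stirling2 flip: deg_stirling2_eq_binomial_sum)

end
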